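(* Let $c,r$ be positive integers with $c<r<2c$, and let $n_1,\dots,n_c$ be positive integers. Then $R(B^rK_{n_1},\dots,B^rK_{n_c})\le \sum_{i=1}^c n_i$.
   Context: An $r$-uniform hypergraph ($r$-graph) consists of a vertex set and a set of $r$-element subsets of it (hyperedges); $\mathcal{K}_N^r$ denotes the complete $r$-graph on $N$ vertices and $K_m$ the complete graph on $m$ vertices. For a graph $F$, an $r$-graph $\mathcal{H}$ contains a Berge-$F$ if there are an injection $\varphi:V(F)\to V(\mathcal{H})$ and an injection $f$ from $E(F)$ to the hyperedges of $\mathcal{H}$ with $\{\varphi(x),\varphi(y)\}\subseteq f(xy)$ for every edge $xy$; $B^rF$ is the family of $r$-uniform Berge copies of $F$. A $c$-coloring assigns to each hyperedge one of the colors $1,\dots,c$. $R(B^rG_1,\dots,B^rG_c)$ is the smallest $N$ such that in every $c$-coloring of $\mathcal{K}_N^r$ there is an $i$ for which the hyperedges of color $i$ contain a Berge-$G_i$. *)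

theory Defs
  imports Main "HOL-Library.FuncSet" "HOL-Library.Extended_Nat"
begin

text \<open>A hypergraph is a pair of a vertex set and a set of hyperedges.\<close>

type_synonym 'a hypergraph = "'a set \<times> 'a set set"

abbreviation verts :: "'a hypergraph \<Rightarrow> 'a set" where
  "verts H \<equiv> fst H"

abbreviation edges :: "'a hypergraph \<Rightarrow> 'a set set" where
  "edges H \<equiv> snd H"

definition complete_uniform :: "nat \<Rightarrow> nat \<Rightarrow> nat hypergraph" where
  "complete_uniform r N = ({..<N}, {e. e \<subseteq> {..<N} \<and> card e = r})"

definition complete_graph :: "nat \<Rightarrow> nat hypergraph" where
  "complete_graph m = complete_uniform 2 m"

text \<open>Intended for a graph \<open>F\<close>, that is, one all of whose edges have two elements.\<close>

definition contains_Berge :: "'a hypergraph \<Rightarrow> 'b hypergraph \<Rightarrow> bool" where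
  "contains_Berge F H \<longleftrightarrow>
     (\<exists>\<phi> f. inj_on \<phi> (verts F) \<and> \<phi> ` verts F \<subseteq> verts H \<and>
            inj_on f (edges F) \<and> f ` edges F \<subseteq> edges H \<and>
            (\<forall>x y. {x, y} \<in> edges F \<longrightarrow> {\<phi> x, \<phi> y} \<subseteq> f {x, y}))"

definition colour_class :: "'a hypergraph \<Rightarrow> ('a set \<Rightarrow> nat) \<Rightarrow> nat \<Rightarrow> 'a hypergraph" where
  "colour_class H \<chi> i = (verts H, {e \<in> edges H. \<chi> e = i})"

definition berge_arrows :: "nat \<Rightarrow> nat \<Rightarrow> (nat \<Rightarrow> 'a hypergraph) \<Rightarrow> nat \<Rightarrow> bool" where
  "berge_arrows r c G N \<longleftrightarrow>
     (\<forall>\<chi> \<in> edges (complete_uniform r N) \<rightarrow> {1..c}.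
        \<exists>i \<in> {1..c}. contains_Berge (G i) (colour_class (complete_uniform r N) \<chi> i))"

text \<open>The value lies in \<^typ>\<open>enat\<close> so that it is \<open>\<infinity>\<close>, and not \<open>0\<close>, if no \<open>N\<close>
  has the property; an upper bound by a number thus includes the existence of such an \<open>N\<close>.\<close>

definition berge_ramsey :: "nat \<Rightarrow> nat \<Rightarrow> (nat \<Rightarrow> 'a hypergraph) \<Rightarrow> enat" where
  "berge_ramsey r c G = Inf {enat N | N. berge_arrows r c G N}"

end

theory Submission imports Defs "HOL-Library.Disjoint_Sets" begin

text \<open>Reserve a set \<open>W\<close> of \<open>r - c - 1\<close> vertices and process the others one at a time, distributing
  them over disjoint nonempty sets \<open>S\<^sub>1, \<dots>, S\<^sub>c\<close> such that \<open>S\<^sub>i\<close> is always the vertex set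
  of a Berge clique of colour \<open>i\<close>. For a new vertex \<open>u\<close>, consider the hyperedges
  \<open>W \<union> {u, v\<^sub>1, \<dots>, v\<^sub>c}\<close> with \<open>v\<^sub>i \<in> S\<^sub>i\<close>. If for every \<open>i\<close> there were some \<open>v\<^sub>i \<in> S\<^sub>i\<close> that lies
  in no such hyperedge of colour \<open>i\<close>, then the hyperedge formed from these \<open>v\<^sub>i\<close> could not have
  any colour. So for some \<open>i\<close> each \<open>v \<in> S\<^sub>i\<close> lies in such a hyperedge of colour \<open>i\<close>; these
  hyperedges are distinct, and unused since they contain \<open>u\<close>, so \<open>u\<close> can be added to \<open>S\<^sub>i\<close>.
  As \<open>r < 2 c\<close>, at least \<open>\<Sum>\<^sub>i (n\<^sub>i - 1) + 1\<close> vertices are distributed.\<close>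

section \<open>Berge cliques on a prescribed vertex set\<close>

text \<open>The core is a set of vertices of the hypergraph itself, without an embedding from
  \<open>complete_graph\<close>, so that it can grow vertex by vertex. The hyperedges
  \<open>f e\<close> may reach outside \<open>S\<close>.\<close>

definition berge_core :: "'a set set \<Rightarrow> 'a set \<Rightarrow> bool" where
  "berge_core H S \<longleftrightarrow>
     (\<exists>f. inj_on f {e. e \<subseteq> S \<and> card e = 2} \<and>
          (\<forall>e. e \<subseteq> S \<and> card e = 2 \<longrightarrow> e \<subseteq> f e \<and> f e \<in> H))"

lemma berge_core_mono:
  assumes "berge_core H S" "H \<subseteq> H'" "S' \<subseteq> S"
  shows "berge_core H' S'"
proof -
  obtain f where f: "inj_on f {e. e \<subseteq> S \<and> card e = 2}"
      "\<And>e. e \<subseteq> S \<Longrightarrow> card e = 2 \<Longrightarrow> e \<subseteq> f e \<and> f e \<in> H"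
    using assms(1) unfolding berge_core_def by blast
  have "inj_on f {e. e \<subseteq> S' \<and> card e = 2}"
    by (rule inj_on_subset[OF f(1)]) (use assms(3) in auto)
  moreover have "e \<subseteq> f e \<and> f e \<in> H'" if "e \<subseteq> S'" "card e = 2" for e
    using f(2)[of e] that assms(2,3) by auto
  ultimately show ?thesis
    unfolding berge_core_def by (intro exI[of _ f]) simp
qed

lemma berge_core_singleton: "berge_core H {x}"
proof -
  have "card e \<noteq> 2" if "e \<subseteq> {x}" for e
    using card_mono[OF _ that] by simp
  then have "{e. e \<subseteq> {x} \<and> card e = 2} = {}"
    by blast
  then show ?thesis
    unfolding berge_core_def by (intro exI[of _ id]) (simp only: inj_on_empty, blast)
qed

text \<open>Old pairs keep their hyperedges and the pair \<open>{u, v}\<close> receives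
  \<open>g v\<close>. Since no member of \<open>H\<close> contains \<open>u\<close>, the new
  hyperedges cannot clash with the old ones.\<close>

lemma berge_core_insert:
  assumes core: "berge_core H S"
    and u: "u \<notin> S" "u \<notin> \<Union>H"
    and g: "inj_on g S" "\<And>v. v \<in> S \<Longrightarrow> {u, v} \<subseteq> g v"
  shows "berge_core (H \<union> g ` S) (insert u S)"
proof -
  obtain f where f: "inj_on f {e. e \<subseteq> S \<and> card e = 2}"
      "\<And>e. e \<subseteq> S \<Longrightarrow> card e = 2 \<Longrightarrow> e \<subseteq> f e \<and> f e \<in> H"
    using core unfolding berge_core_def by blast
  \<comment> \<open>For \<open>e = {u, v}\<close> the term \<open>the_elem (e - {u})\<close>
    recovers \<open>v\<close>.\<close>
  define f' where "f' e = (if u \<in> e then g (the_elem (e - {u})) else f e)" for e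
  have new: "\<exists>v\<in>S. e = {u, v} \<and> f' e = g v"
    if "e \<subseteq> insert u S" "card e = 2" "u \<in> e" for e
  proof -
    obtain v where v: "e = {u, v}" "v \<noteq> u"
      using \<open>card e = 2\<close> \<open>u \<in> e\<close> by (auto simp: card_2_iff)
    then have "e - {u} = {v}" by auto
    with v that show ?thesis by (auto simp: f'_def)
  qed
  have old: "e \<subseteq> S \<and> f' e = f e" if "e \<subseteq> insert u S" "u \<notin> e" for e
    using that by (auto simp: f'_def)
  \<comment> \<open>The value \<open>f' e\<close> thus reveals whether \<open>e\<close> is a new or
    an old pair, so injectivity can be checked for each kind separately.\<close>
  have mem: "u \<in> f' e \<longleftrightarrow> u \<in> e" if "e \<subseteq> insert u S" "card e = 2" for e
  proof (cases "u \<in> e")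
    case True
    with new[OF that] g(2) show ?thesis by fastforce
  next
    case False
    with old[OF that(1)] f(2)[of e] that(2) u(2) show ?thesis by auto
  qed
  have "inj_on f' {e. e \<subseteq> insert u S \<and> card e = 2}"
  proof (rule inj_onI, clarify)
    fix d e
    assume d: "d \<subseteq> insert u S" "card d = 2" and e: "e \<subseteq> insert u S" "card e = 2"
      and eq: "f' d = f' e"
    have iff: "u \<in> d \<longleftrightarrow> u \<in> e"
      using mem[OF d] mem[OF e] eq by simp
    show "d = e"
    proof (cases "u \<in> d")
      case True
      with new[OF d] new[OF e] iff obtain v w
        where "v \<in> S" "w \<in> S" "d = {u, v}" "e = {u, w}" "g v = g w"
        using eq by auto
      with g(1) show ?thesis by (auto dest: inj_onD)
    next
      case False
      with old[OF d(1)] old[OF e(1)] iff eq d e f(1) show ?thesis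
        by (auto dest: inj_onD)
    qed
  qed
  moreover have "e \<subseteq> f' e \<and> f' e \<in> H \<union> g ` S"
    if "e \<subseteq> insert u S" "card e = 2" for e
  proof (cases "u \<in> e")
    case True
    with new[OF that] g(2) show ?thesis by fastforce
  next
    case False
    with old[OF that(1)] f(2)[of e] that(2) show ?thesis by simp
  qed
  ultimately show ?thesis
    unfolding berge_core_def by (intro exI[of _ f']) simp
qed

section \<open>Distributing the vertices over disjoint cores\<close>

text \<open>Otherwise every \<open>i\<close> has a bad value \<open>q i\<close>, and the choice
  function \<open>q\<close> itself, whose colour is some \<open>i\<close> in \<open>I\<close>,
  contradicts the badness of \<open>q i\<close>.\<close>

lemma transversal_colour:
  assumes "\<And>p. p \<in> Pi I S \<Longrightarrow> \<chi> p \<in> I"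
  obtains i where "i \<in> I" "\<And>v. v \<in> S i \<Longrightarrow> \<exists>p \<in> Pi I S. p i = v \<and> \<chi> p = i"
proof (rule ccontr)
  assume "\<not> thesis"
  then have "\<forall>i\<in>I. \<exists>v. v \<in> S i \<and> (\<forall>p \<in> Pi I S. p i = v \<longrightarrow> \<chi> p \<noteq> i)"
    using that by meson
  then obtain q where q: "\<And>i. i \<in> I \<Longrightarrow> q i \<in> S i"
      "\<And>i p. i \<in> I \<Longrightarrow> p \<in> Pi I S \<Longrightarrow> p i = q i \<Longrightarrow> \<chi> p \<noteq> i"
    unfolding bchoice_iff by blast
  then have "q \<in> Pi I S" by simp
  with assms[of q] q(2)[of _ q] show False by blast
qed

text \<open>Induction on \<open>m\<close>, with \<open>{..<r - c - 1}\<close> as the reserved set.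
  Only hyperedges inside \<open>{..<m}\<close> are used so far, so every hyperedge through the next
  vertex \<open>m\<close> is still free.\<close>

lemma disjoint_berge_cores:
  fixes \<chi> :: "nat set \<Rightarrow> nat"
  assumes c: "c < r" and m: "r - 1 \<le> m" and N: "m \<le> N"
    and \<chi>: "\<chi> \<in> edges (complete_uniform r N) \<rightarrow> {1..c}"
  shows "\<exists>S. (\<forall>i\<in>{1..c}. S i \<noteq> {} \<and> berge_core {h. h \<subseteq> {..<m} \<and> card h = r \<and> \<chi> h = i} (S i))
             \<and> disjoint_family_on S {1..c} \<and> (\<Union>i\<in>{1..c}. S i) = {r - c - 1..<m}"
  using m N
proof (induction m rule: dec_induct)
  case base
  \<comment> \<open>The first \<open>c\<close> unreserved vertices, one for each colour;
    \<open>i - 1\<close> appears because colours start at 1.\<close>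
  let ?S = "\<lambda>i. {r - c - 1 + (i - 1)}"
  have "x \<in> (\<Union>i\<in>{1..c}. ?S i)" if "x \<in> {r - c - 1..<r - 1}" for x
    by (rule UN_I[of "x - (r - c - 1) + 1"]) (use that c in auto)
  then have "(\<Union>i\<in>{1..c}. ?S i) = {r - c - 1..<r - 1}"
    using c by auto
  moreover have "disjoint_family_on ?S {1..c}"
    by (auto simp: disjoint_family_on_def)
  ultimately show ?case
    using berge_core_singleton by (intro exI[of _ ?S]) auto
next
  case (step m)
  define H where "H i m = {h. h \<subseteq> {..<m} \<and> card h = r \<and> \<chi> h = i}" for i m
  obtain S where S: "\<And>i. i \<in> {1..c} \<Longrightarrow> S i \<noteq> {}" "\<And>i. i \<in> {1..c} \<Longrightarrow> berge_core (H i m) (S i)"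
      and disj: "disjoint_family_on S {1..c}" and un: "(\<Union>i\<in>{1..c}. S i) = {r - c - 1..<m}"
    using step.IH step.prems unfolding H_def by (meson Suc_leD)
  have sub: "S j \<subseteq> {r - c - 1..<m}" if "j \<in> {1..c}" for j
    using un that by blast
  have notin: "m \<notin> S j" if "j \<in> {1..c}" for j
    using sub[OF that] by auto
  \<comment> \<open>This has \<open>(r - c - 1) + c + 1 = r\<close> elements: disjointness of the
    sets \<open>S i\<close> makes the chosen vertices distinct.\<close>
  define h where "h p = insert m (p ` {1..c} \<union> {..<r - c - 1})" for p :: "nat \<Rightarrow> nat"
  have p_in: "p i \<in> {r - c - 1..<m}" if "p \<in> Pi {1..c} S" "i \<in> {1..c}" for p i
    using Pi_mem[OF that] sub[OF that(2)] by blast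
  have h: "h p \<subseteq> {..<Suc m} \<and> card (h p) = r" if p: "p \<in> Pi {1..c} S" for p
  proof -
    have "inj_on p {1..c}"
    proof (rule inj_onI)
      fix i j assume ij: "i \<in> {1..c}" "j \<in> {1..c}" "p i = p j"
      then have "p i \<in> S i \<inter> S j"
        using Pi_mem[OF p ij(1)] Pi_mem[OF p ij(2)] by simp
      then show "i = j" using disjoint_family_onD[OF disj ij(1,2)] by blast
    qed
    then have "card (p ` {1..c}) = c" by (simp add: card_image)
    moreover have "p ` {1..c} \<inter> {..<r - c - 1} = {}"
      using p_in[OF p] by fastforce
    ultimately have "card (p ` {1..c} \<union> {..<r - c - 1}) = r - 1"
      using c by (subst card_Un_disjoint) auto
    moreover have h_sub: "p ` {1..c} \<union> {..<r - c - 1} \<subseteq> {..<m}"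
      using p_in[OF p] step.hyps by fastforce
    moreover have "m \<notin> p ` {1..c} \<union> {..<r - c - 1}"
      using h_sub by auto
    ultimately show ?thesis
      using c unfolding h_def by (auto simp: less_Suc_eq)
  qed
  have col: "\<chi> (h p) \<in> {1..c}" if "p \<in> Pi {1..c} S" for p
  proof -
    have "h p \<in> edges (complete_uniform r N)"
      using h[OF that] step.prems by (auto simp: complete_uniform_def)
    with \<chi> show ?thesis by blast
  qed
  obtain i where i: "i \<in> {1..c}"
      and ex: "\<And>v. v \<in> S i \<Longrightarrow> \<exists>p \<in> Pi {1..c} S. p i = v \<and> \<chi> (h p) = i"
    using transversal_colour[of "{1..c}" S "\<lambda>p. \<chi> (h p)"] col by blast
  obtain q where q: "\<And>v. v \<in> S i \<Longrightarrow> q v \<in> Pi {1..c} S \<and> q v i = v \<and> \<chi> (h (q v)) = i"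
    using ex bchoice[of "S i" "\<lambda>v p. p \<in> Pi {1..c} S \<and> p i = v \<and> \<chi> (h p) = i"] by blast
  \<comment> \<open>By disjointness, the only chosen vertex in \<open>S i\<close> is the one chosen
    for \<open>i\<close>. Hence \<open>v\<close> can be read off from its hyperedge, which makes the
    assignment injective.\<close>
  have trace: "h (q v) \<inter> S i = {v}" if v: "v \<in> S i" for v
  proof -
    have "h (q v) \<inter> S i = (q v ` {1..c}) \<inter> S i"
      using sub[OF i] unfolding h_def by auto
    also have "\<dots> = {v}"
    proof -
      have "j = i" if j: "j \<in> {1..c}" "q v j \<in> S i" for j
      proof -
        have "q v j \<in> S i \<inter> S j"
          using j Pi_mem[of "q v" "{1..c}" S j] q[OF v] by blast
        then show ?thesis using disjoint_family_onD[OF disj i j(1)] by blast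
      qed
      then have "q v ` {1..c} \<inter> S i \<subseteq> {q v i}" by blast
      moreover have "q v i \<in> q v ` {1..c}" using i by (rule imageI)
      ultimately show ?thesis using q[OF v] v by auto
    qed
    finally show ?thesis .
  qed
  have "inj_on (\<lambda>v. h (q v)) (S i)"
    by (rule inj_onI) (metis trace singleton_inject)
  moreover have "{m, v} \<subseteq> h (q v)" if "v \<in> S i" for v
    using trace[OF that] by (auto simp: h_def)
  moreover note notin[OF i]
  moreover have "m \<notin> \<Union>(H i m)" by (auto simp: H_def)
  ultimately have core: "berge_core (H i m \<union> (\<lambda>v. h (q v)) ` S i) (insert m (S i))"
    using S(2)[OF i] by (intro berge_core_insert) auto
  have mono: "H j m \<subseteq> H j (Suc m)" for j
    by (auto simp: H_def)
  have "(\<lambda>v. h (q v)) ` S i \<subseteq> H i (Suc m)"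
    using h q by (auto simp: H_def)
  then have new: "berge_core (H i (Suc m)) (insert m (S i))"
    by (rule berge_core_mono[OF core Un_least[OF mono] order_refl])
  define S' where "S' = S(i := insert m (S i))"
  have "S' j \<noteq> {} \<and> berge_core (H j (Suc m)) (S' j)" if "j \<in> {1..c}" for j
    using new S[OF that] mono[of j] berge_core_mono[OF _ mono order_refl]
    by (simp add: S'_def)
  moreover have "disjoint_family_on S' {1..c}"
    using disj notin i by (simp add: S'_def disjoint_family_on_def)
  moreover have "(\<Union>j\<in>{1..c}. S' j) = {r - c - 1..<Suc m}"
  proof -
    have "(\<Union>j\<in>{1..c}. S' j) = insert m (\<Union>j\<in>{1..c}. S j)"
      using i by (auto simp: S'_def split: if_splits)
    then show ?thesis using un step.hyps c by auto
  qed
  ultimately show ?case unfolding H_def by (intro exI[of _ S']) simp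
qed

section \<open>From cores to the Ramsey bound\<close>

lemma contains_Berge_complete_graph:
  assumes "berge_core (edges G) S" "S \<subseteq> verts G" "n = card S" "finite S"
  shows "contains_Berge (complete_graph n) G"
proof -
  obtain f where f: "inj_on f {e. e \<subseteq> S \<and> card e = 2}"
      "\<And>e. e \<subseteq> S \<Longrightarrow> card e = 2 \<Longrightarrow> e \<subseteq> f e \<and> f e \<in> edges G"
    using assms(1) unfolding berge_core_def by blast
  obtain \<phi> where \<phi>: "bij_betw \<phi> {..<n} S"
    using assms(3,4) ex_bij_betw_nat_finite[of S] by (auto simp: atLeast0LessThan)
  then have inj: "inj_on \<phi> {..<n}" and img: "\<phi> ` {..<n} = S"
    by (auto simp: bij_betw_def)
  have image: "\<phi> ` e \<subseteq> S \<and> card (\<phi> ` e) = 2" if "e \<subseteq> {..<n}" "card e = 2" for e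
    using image_mono[OF that(1), of \<phi>] card_image[OF inj_on_subset[OF inj that(1)]] that(2) img
    by simp
  have "inj_on (\<lambda>e. f (\<phi> ` e)) {e. e \<subseteq> {..<n} \<and> card e = 2}"
  proof (rule inj_onI, clarify)
    fix d e
    assume d: "d \<subseteq> {..<n}" "card d = 2" and e: "e \<subseteq> {..<n}" "card e = 2"
      and "f (\<phi> ` d) = f (\<phi> ` e)"
    then have "\<phi> ` d = \<phi> ` e"
      using inj_onD[OF f(1), of "\<phi> ` d" "\<phi> ` e"] image[OF d] image[OF e] by blast
    then show "d = e"
      using inj d(1) e(1) by (simp add: inj_on_image_eq_iff)
  qed
  moreover have f_edges: "\<phi> ` e \<subseteq> f (\<phi> ` e) \<and> f (\<phi> ` e) \<in> edges G"
    if "e \<subseteq> {..<n}" "card e = 2" for e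
    using image[OF that] f(2) by simp
  moreover have "{\<phi> x, \<phi> y} \<subseteq> f (\<phi> ` {x, y})"
    if "{x, y} \<subseteq> {..<n}" "card {x, y} = 2" for x y
    using f_edges[OF that] by simp
  ultimately show ?thesis
    unfolding contains_Berge_def complete_graph_def complete_uniform_def fst_conv snd_conv
    using inj img assms(2)
    by (intro exI[of _ \<phi>] exI[of _ "\<lambda>e. f (\<phi> ` e)"] conjI)
      (simp_all del: insert_subset add: image_subset_iff)
qed

text \<open>Pigeonhole: the cores share \<open>N - (r - c - 1)\<close> vertices, more than the sum
  of the \<open>n i - 1\<close>, so some core has at least \<open>n i\<close> vertices.\<close>

lemma berge_arrows_complete_graphs:
  fixes n :: "nat \<Rightarrow> nat"
  assumes c: "c < r" and n: "\<And>i. i \<in> {1..c} \<Longrightarrow> 2 \<le> n i"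
    and N: "(\<Sum>i=1..c. n i - 1) + (r - c) \<le> N"
  shows "berge_arrows r c (\<lambda>i. complete_graph (n i)) N"
  unfolding berge_arrows_def
proof
  fix \<chi> assume \<chi>: "\<chi> \<in> edges (complete_uniform r N) \<rightarrow> {1..c}"
  \<comment> \<open>Each \<open>n i - 1\<close> is at least 1, so \<open>N\<close> is large enough
    for the induction to have started.\<close>
  have "c = (\<Sum>i=1..c. 1)" by simp
  also have "\<dots> \<le> (\<Sum>i=1..c. n i - 1)"
  proof (rule sum_mono)
    show "1 \<le> n i - 1" if "i \<in> {1..c}" for i
      using n[OF that] by linarith
  qed
  finally have "r - 1 \<le> N" using N by linarith
  then obtain S where S: "\<And>i. i \<in> {1..c} \<Longrightarrow>
        berge_core {h. h \<subseteq> {..<N} \<and> card h = r \<and> \<chi> h = i} (S i)"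
      and disj: "disjoint_family_on S {1..c}" and un: "(\<Union>i\<in>{1..c}. S i) = {r - c - 1..<N}"
    using disjoint_berge_cores[OF c _ order_refl \<chi>] by blast
  have sub: "S i \<subseteq> {..<N}" if "i \<in> {1..c}" for i
    using un that by fastforce
  then have fin: "finite (S i)" if "i \<in> {1..c}" for i
    using that finite_subset by blast
  have "(\<Sum>i=1..c. n i - 1) < N - (r - c - 1)"
    using N c by linarith
  also have "\<dots> = card (\<Union>i\<in>{1..c}. S i)"
    by (subst un) simp
  also have "\<dots> \<le> (\<Sum>i=1..c. card (S i))"
    by (rule card_UN_le) simp
  finally obtain i where i: "i \<in> {1..c}" and "n i - 1 < card (S i)"
    by (metis (no_types, lifting) not_le sum_mono)
  then have "n i \<le> card (S i)" by linarith
  then obtain T where T: "T \<subseteq> S i" "card T = n i" "finite T"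
    using obtain_subset_with_card_n by blast
  have "contains_Berge (complete_graph (n i)) (colour_class (complete_uniform r N) \<chi> i)"
  proof (rule contains_Berge_complete_graph)
    show "berge_core (edges (colour_class (complete_uniform r N) \<chi> i)) T"
      using S[OF i] by (rule berge_core_mono)
        (use T in \<open>auto simp: colour_class_def complete_uniform_def\<close>)
    show "T \<subseteq> verts (colour_class (complete_uniform r N) \<chi> i)"
      using T sub[OF i] by (auto simp: colour_class_def complete_uniform_def)
  qed (use T in auto)
  with i show "\<exists>i\<in>{1..c}. contains_Berge (complete_graph (n i))
      (colour_class (complete_uniform r N) \<chi> i)" by blast
qed

theorem theorem3:
  fixes c r :: nat and n :: "nat \<Rightarrow> nat"
  assumes "0 < c" and "0 < r" and "c < r" and "r < 2 * c"
    and "\<And>i. i \<in> {1..c} \<Longrightarrow> 0 < n i"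
  shows "berge_ramsey r c (\<lambda>i. complete_graph (n i)) \<le> enat (\<Sum>i=1..c. n i)"
proof -
  let ?N = "\<Sum>i=1..c. n i"
  have "berge_arrows r c (\<lambda>i. complete_graph (n i)) ?N"
  \<comment> \<open>A Berge copy of the one-vertex graph needs no hyperedge, so any vertex serves.
    In the other case all \<open>n i\<close> are at least 2, as the pigeonhole lemma
    requires.\<close>
  proof (cases "\<exists>i\<in>{1..c}. n i = 1")
    case True
    then obtain i where i: "i \<in> {1..c}" "n i = 1" by blast
    then have "n i \<le> ?N" by (intro member_le_sum) auto
    with i have N: "0 < ?N" by simp
    have "contains_Berge (complete_graph (n i)) (colour_class (complete_uniform r ?N) \<chi> i)" for \<chi>
      by (rule contains_Berge_complete_graph[where S = "{0}"])
        (use i N in \<open>auto simp: berge_core_singleton colour_class_def complete_uniform_def\<close>)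
    with i(1) show ?thesis unfolding berge_arrows_def by blast
  next
    case False
    have n: "2 \<le> n i" if "i \<in> {1..c}" for i
    proof -
      have "n i \<noteq> 0" "n i \<noteq> 1" using False assms(5) that by auto
      then show ?thesis by linarith
    qed
    \<comment> \<open>Positivity of \<open>n i\<close> makes the truncated subtraction exact. As
      \<open>r < 2 * c\<close> gives \<open>r - c \<le> c\<close>, the required lower bound on
      \<open>N\<close> follows.\<close>
    have "(\<Sum>i=1..c. n i - 1) + c = (\<Sum>i=1..c. (n i - 1) + 1)"
      by (simp only: sum.distrib) simp
    also have "\<dots> = ?N"
      by (rule sum.cong) (use assms(5) in auto)
    finally show ?thesis
      using assms(3,4) n by (intro berge_arrows_complete_graphs) auto
  qed
  then show ?thesis
    unfolding berge_ramsey_def by (intro Inf_lower) blast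
qed

end
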